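(* Suppose that $\alpha\in\mathbb{Q}\cap(0,1)$ appears in the Stern--Brocot tree for the first time in level $n+1$ for some natural number $n\ge 1$. Then the closure of the graph of the real-valued function $\varphi_\alpha$ on $I_\alpha=\left(\frac{a_n(\alpha)}{b_n(\alpha)},\frac{c_n(\alpha)}{d_n(\alpha)}\right)$ defined by $$\varphi_\alpha(x)=\sum_{i=1}^n\min\left(b_i(\alpha)\cdot x-a_i(\alpha),\ c_i(\alpha)-d_i(\alpha)\cdot x\right)$$ consists of two line segments connecting $$\left(\frac{a_n(\alpha)}{b_n(\alpha)},\frac{b_n(\alpha)-1}{b_n(\alpha)}\right),\quad \left(\frac{a_n(\alpha)+c_n(\alpha)}{b_n(\alpha)+d_n(\alpha)},\frac{b_n(\alpha)+d_n(\alpha)-1}{b_n(\alpha)+d_n(\alpha)}\right),\quad \left(\frac{c_n(\alpha)}{d_n(\alpha)},\frac{d_n(\alpha)-1}{d_n(\alpha)}\right)$$ in this order. In particular, the maximum of $\varphi_\alpha$ on $I_\alpha$ occurs at $\alpha=\frac{a_n(\alpha)+c_n(\alpha)}{b_n(\alpha)+d_n(\alpha)}$.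
   Context: The mediant of two fractions $\frac ab$ and $\frac cd$ is $\frac{a+c}{b+d}$. The (left side of the) Stern--Brocot tree is constructed as follows: level $1$ consists of $\frac01$ and $\frac11$; level $j+1$ is obtained from level $j$ by keeping all elements of level $j$ and inserting the mediant of every pair of neighboring elements of level $j$. So level $2$ is $\frac01,\frac12,\frac11$; level $3$ is $\frac01,\frac13,\frac12,\frac23,\frac11$; and so on (all fractions are in reduced form, listed in increasing order; level $j$ subdivides $[0,1]$ into $2^{j-1}$ subintervals). For a natural number $i$ and $x\in[0,1]$ not itself appearing in level $i$, the Farey interval of $x$ at level $i$ is the subinterval of $[0,1]$ between neighboring elements of level $i$ that contains $x$; its initial (left) point is written $\frac{a_i(x)}{b_i(x)}$ and its end (right) point $\frac{c_i(x)}{d_i(x)}$, where numerators and denominators are those of the fractions as they occur in the tree. *)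

theory Defs
  imports "HOL-Analysis.Analysis"
begin

text \<open>
  A fraction is represented by the pair of its numerator and denominator as they occur in the
  Stern--Brocot tree; the pairs are never cancelled.
\<close>

type_synonym fraction = "nat \<times> nat"

definition value_of :: "fraction \<Rightarrow> real" where
  "value_of p = real (fst p) / real (snd p)"

definition mediant :: "fraction \<Rightarrow> fraction \<Rightarrow> fraction" where
  "mediant p q = (fst p + fst q, snd p + snd q)"

fun insert_mediants :: "fraction list \<Rightarrow> fraction list" where
  "insert_mediants (p # q # ps) = p # mediant p q # insert_mediants (q # ps)"
| "insert_mediants ps = ps"

text \<open>Levels are numbered from 1; the list for level 0 is a dummy.\<close>

fun sb_level :: "nat \<Rightarrow> fraction list" where
  "sb_level 0 = []"
| "sb_level (Suc 0) = [(0, 1), (1, 1)]"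
| "sb_level (Suc (Suc j)) = insert_mediants (sb_level (Suc j))"

definition appears_in_level :: "real \<Rightarrow> nat \<Rightarrow> bool" where
  "appears_in_level x i \<longleftrightarrow> x \<in> value_of ` set (sb_level i)"

definition first_appears_in_level :: "real \<Rightarrow> nat \<Rightarrow> bool" where
  "first_appears_in_level x i \<longleftrightarrow>
     appears_in_level x i \<and> (\<forall>j. 1 \<le> j \<and> j < i \<longrightarrow> \<not> appears_in_level x j)"

definition neighbours_in_level :: "nat \<Rightarrow> fraction \<Rightarrow> fraction \<Rightarrow> bool" where
  "neighbours_in_level i p q \<longleftrightarrow>
     (\<exists>k. Suc k < length (sb_level i) \<and> p = sb_level i ! k \<and> q = sb_level i ! Suc k)"

text \<open>
  The description below is proper whenever \<open>i \<ge> 1\<close>, \<open>0 \<le> x \<le> 1\<close> and \<open>x\<close> does not itself appear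
  in level \<open>i\<close>; otherwise the result is unspecified.
\<close>

definition farey_interval :: "nat \<Rightarrow> real \<Rightarrow> fraction \<times> fraction" where
  "farey_interval i x =
     (THE I. neighbours_in_level i (fst I) (snd I) \<and>
             value_of (fst I) < x \<and> x < value_of (snd I))"

definition farey_a :: "nat \<Rightarrow> real \<Rightarrow> nat" where
  "farey_a i x = fst (fst (farey_interval i x))"

definition farey_b :: "nat \<Rightarrow> real \<Rightarrow> nat" where
  "farey_b i x = snd (fst (farey_interval i x))"

definition farey_c :: "nat \<Rightarrow> real \<Rightarrow> nat" where
  "farey_c i x = fst (snd (farey_interval i x))"

definition farey_d :: "nat \<Rightarrow> real \<Rightarrow> nat" where
  "farey_d i x = snd (snd (farey_interval i x))"

definition farey_phi :: "nat \<Rightarrow> real \<Rightarrow> real \<Rightarrow> real" where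
  "farey_phi n \<alpha> x =
     (\<Sum>i=1..n. min (real (farey_b i \<alpha>) * x - real (farey_a i \<alpha>))
                    (real (farey_c i \<alpha>) - real (farey_d i \<alpha>) * x))"

end

theory Submission
  imports Defs
begin

text \<open>
  Write \<open>X\<^sub>i = b\<^sub>i x - a\<^sub>i\<close> and \<open>Y\<^sub>i = c\<^sub>i - d\<^sub>i x\<close> for the two quantities in the \<open>i\<close>-th summand. Passing to the
  next level replaces \<open>(X, Y)\<close> by \<open>(X, Y - X)\<close> or \<open>(X - Y, Y)\<close>, according to the side of the
  mediant; on the chosen side, \<open>max X Y\<close> becomes the sum of the new pair. Together with
  \<open>min X Y = X + Y - max X Y\<close> this telescopes to \<open>\<phi>(x) = 1 - max X\<^sub>n Y\<^sub>n\<close> on the \<open>n\<close>-th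
  Farey interval, from which everything is read off using \<open>b c - a d = 1\<close>.
\<close>

section \<open>Adjacent entries of a list and the insertion of mediants\<close>

definition adjacent :: "'a list \<Rightarrow> 'a \<Rightarrow> 'a \<Rightarrow> bool" where
  "adjacent xs p q \<longleftrightarrow> (\<exists>k. Suc k < length xs \<and> p = xs ! k \<and> q = xs ! Suc k)"

text \<open>Adjacency is taken over arbitrary lists because inductions along
  \<open>insert_mediants\<close> pass to tails, which are not levels themselves.\<close>

lemma neighbours_in_level_iff_adjacent:
  "neighbours_in_level i p q \<longleftrightarrow> adjacent (sb_level i) p q"
  by (simp add: neighbours_in_level_def adjacent_def)

lemma adjacent_Nil [simp]: "\<not> adjacent [] p q"
  by (simp add: adjacent_def)

lemma adjacent_singleton [simp]: "\<not> adjacent [x] p q"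
  by (simp add: adjacent_def)

lemma adjacent_Cons_Cons [simp]:
  "adjacent (x # y # zs) p q \<longleftrightarrow> (p = x \<and> q = y) \<or> adjacent (y # zs) p q"
proof
  assume "adjacent (x # y # zs) p q"
  then obtain k where "Suc k < length (x # y # zs)"
    "p = (x # y # zs) ! k" "q = (x # y # zs) ! Suc k"
    by (auto simp: adjacent_def)
  then show "(p = x \<and> q = y) \<or> adjacent (y # zs) p q"
    by (cases k) (auto simp: adjacent_def)
next
  assume "(p = x \<and> q = y) \<or> adjacent (y # zs) p q"
  then show "adjacent (x # y # zs) p q"
  proof
    assume "adjacent (y # zs) p q"
    then obtain k where "Suc k < length (y # zs)" "p = (y # zs) ! k" "q = (y # zs) ! Suc k"
      by (auto simp: adjacent_def)
    then show ?thesis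
      unfolding adjacent_def by (intro exI[of _ "Suc k"]) auto
  qed (auto simp: adjacent_def)
qed

lemma successively_adjacent: "successively R xs \<Longrightarrow> adjacent xs p q \<Longrightarrow> R p q"
  by (auto simp: adjacent_def successively_conv_nth)

text \<open>Exposes the head of the recursive call, so that \<open>adjacent_Cons_Cons\<close> can
  simplify at the seam after an inserted mediant.\<close>

lemma insert_mediants_Cons: "\<exists>zs. insert_mediants (p # ps) = p # zs"
  by (cases ps) auto

lemma adjacent_insert_mediants:
  assumes "adjacent xs p q"
  shows "adjacent (insert_mediants xs) p (mediant p q)"
    and "adjacent (insert_mediants xs) (mediant p q) q"
proof -
  have "adjacent (insert_mediants xs) p (mediant p q) \<and>
        adjacent (insert_mediants xs) (mediant p q) q"
    using assms
  proof (induction xs rule: insert_mediants.induct)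
    case (1 x y zs)
    obtain ws where "insert_mediants (y # zs) = y # ws"
      using insert_mediants_Cons by blast
    with 1 show ?case by auto
  qed auto
  then show "adjacent (insert_mediants xs) p (mediant p q)"
    and "adjacent (insert_mediants xs) (mediant p q) q" by auto
qed

lemma set_insert_mediants_cases:
  assumes "r \<in> set (insert_mediants xs)"
  obtains "r \<in> set xs" | p q where "adjacent xs p q" "r = mediant p q"
proof -
  have "r \<in> set xs \<or> (\<exists>p q. adjacent xs p q \<and> r = mediant p q)"
    using assms by (induction xs rule: insert_mediants.induct) auto
  then show ?thesis using that by blast
qed

section \<open>Unimodularity of neighbours and the order of a level\<close>

text \<open>The determinant condition \<open>b c - a d = 1\<close>, written additively to avoid
  truncated subtraction on \<open>nat\<close>.\<close>

definition unimodular :: "fraction \<Rightarrow> fraction \<Rightarrow> bool" where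
  "unimodular p q \<longleftrightarrow> 0 < snd p \<and> 0 < snd q \<and> fst q * snd p = fst p * snd q + 1"

text \<open>A determinant is unchanged when one of its rows is added to the other.\<close>

lemma unimodular_mediant:
  assumes "unimodular p q"
  shows "unimodular p (mediant p q)" and "unimodular (mediant p q) q"
  using assms by (auto simp: unimodular_def mediant_def algebra_simps)

lemma unimodular_real:
  assumes "unimodular p q"
  shows "real (snd p) * real (fst q) - real (fst p) * real (snd q) = 1"
proof -
  have "real (fst q * snd p) = real (fst p * snd q + 1)"
    using assms by (simp only: unimodular_def)
  then show ?thesis by (simp add: algebra_simps)
qed

text \<open>The two values differ by \<open>1 / (b d)\<close>, which is positive.\<close>

lemma unimodular_less: "unimodular p q \<Longrightarrow> value_of p < value_of q"
  using unimodular_real[of p q]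
  by (simp add: unimodular_def value_of_def divide_less_eq less_divide_eq field_simps)

lemma unimodular_insert_mediants:
  "successively unimodular xs \<Longrightarrow> successively unimodular (insert_mediants xs)"
proof (induction xs rule: insert_mediants.induct)
  case (1 x y zs)
  obtain ws where "insert_mediants (y # zs) = y # ws"
    using insert_mediants_Cons by blast
  with 1 show ?case by (auto intro: unimodular_mediant)
qed auto

lemma successively_unimodular_sb_level: "successively unimodular (sb_level i)"
proof (induction i rule: sb_level.induct)
  case 2
  show ?case by (simp add: unimodular_def)
qed (simp_all add: unimodular_insert_mediants)

lemma neighbours_unimodular: "neighbours_in_level i p q \<Longrightarrow> unimodular p q"
  using successively_adjacent[OF successively_unimodular_sb_level]
  by (simp add: neighbours_in_level_iff_adjacent)

lemma sorted_sb_level: "sorted_wrt (\<lambda>p q. value_of p < value_of q) (sb_level i)"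
proof -
  have "successively (\<lambda>p q. value_of p < value_of q) (sb_level i)"
    using successively_unimodular_sb_level by (rule successively_mono) (rule unimodular_less)
  moreover have "transp (\<lambda>p q. value_of p < value_of q)"
    by (auto simp: transp_def)
  ultimately show ?thesis by (simp add: successively_conv_sorted_wrt)
qed

section \<open>Uniqueness of the Farey interval\<close>

text \<open>Of two different neighbouring pairs in a sorted level, one ends no later than the other
  begins, so no point lies strictly inside both.\<close>

lemma neighbours_around_unique:
  assumes "neighbours_in_level i p q" "value_of p < x" "x < value_of q"
    and "neighbours_in_level i p' q'" "value_of p' < x" "x < value_of q'"
  shows "p = p' \<and> q = q'"
proof -
  obtain k where k: "Suc k < length (sb_level i)" "p = sb_level i ! k" "q = sb_level i ! Suc k"
    using assms(1) by (auto simp: neighbours_in_level_def)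
  obtain l where l: "Suc l < length (sb_level i)" "p' = sb_level i ! l" "q' = sb_level i ! Suc l"
    using assms(4) by (auto simp: neighbours_in_level_def)
  have le: "value_of (sb_level i ! m) \<le> value_of (sb_level i ! m')"
    if "m \<le> m'" "m' < length (sb_level i)" for m m'
    using sorted_wrt_nth_less[OF sorted_sb_level[of i], of m m'] that
    by (cases "m = m'") auto
  have "k = l"
  proof (cases k l rule: linorder_cases)
    case less
    then have "value_of q \<le> value_of p'" using le[of "Suc k" l] k l by simp
    with assms show ?thesis by linarith
  next
    case greater
    then have "value_of q' \<le> value_of p" using le[of "Suc l" k] k l by simp
    with assms show ?thesis by linarith
  qed
  with k l show ?thesis by simp
qed

lemma farey_interval_eq:
  assumes "neighbours_in_level i p q" "value_of p < x" "x < value_of q"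
  shows "farey_interval i x = (p, q)"
  unfolding farey_interval_def
proof (rule the_equality)
  fix I
  assume "neighbours_in_level i (fst I) (snd I) \<and> value_of (fst I) < x \<and> x < value_of (snd I)"
  then show "I = (p, q)"
    using neighbours_around_unique[OF assms, of "fst I" "snd I"] by (simp add: prod_eq_iff)
qed (simp add: assms)

section \<open>The two gaps and their behaviour under mediants\<close>

lemma value_of_mediant:
  "value_of (mediant p q) = (real (fst p) + real (fst q)) / (real (snd p) + real (snd q))"
  by (simp add: value_of_def mediant_def)

definition left_gap :: "fraction \<Rightarrow> real \<Rightarrow> real" where
  "left_gap p x = real (snd p) * x - real (fst p)"

definition right_gap :: "fraction \<Rightarrow> real \<Rightarrow> real" where
  "right_gap q x = real (fst q) - real (snd q) * x"

lemma farey_phi_Suc: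
  "farey_phi (Suc n) \<alpha> x = farey_phi n \<alpha> x +
     min (left_gap (fst (farey_interval (Suc n) \<alpha>)) x)
         (right_gap (snd (farey_interval (Suc n) \<alpha>)) x)"
  by (simp add: farey_phi_def left_gap_def right_gap_def farey_a_def farey_b_def farey_c_def
      farey_d_def)

text \<open>Both gaps are additive in the fraction, and on the same fraction they are negatives of
  each other. This is the passage from \<open>(X, Y)\<close> to \<open>(X, Y - X)\<close> or
  \<open>(X - Y, Y)\<close>.\<close>

lemma gaps_mediant:
  "left_gap (mediant p q) x = left_gap p x - right_gap q x"
  "right_gap (mediant p q) x = right_gap q x - left_gap p x"
  by (simp_all add: left_gap_def right_gap_def mediant_def algebra_simps)

text \<open>The difference \<open>right_gap q x - left_gap p x\<close> is the right gap of the
  mediant: affine in \<open>x\<close>, decreasing, and zero at the mediant's value.\<close>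

lemma gap_le_iff_mediant:
  assumes "unimodular p q"
  shows "left_gap p x \<le> right_gap q x \<longleftrightarrow> x \<le> value_of (mediant p q)"
    and "right_gap q x \<le> left_gap p x \<longleftrightarrow> value_of (mediant p q) \<le> x"
proof -
  have "real (snd p) + real (snd q) > 0"
    using assms by (simp add: unimodular_def)
  then show "left_gap p x \<le> right_gap q x \<longleftrightarrow> x \<le> value_of (mediant p q)"
    and "right_gap q x \<le> left_gap p x \<longleftrightarrow> value_of (mediant p q) \<le> x"
    by (simp_all add: left_gap_def right_gap_def value_of_mediant le_divide_eq divide_le_eq
        algebra_simps)
qed

lemma mediant_between:
  assumes "unimodular p q"
  shows "value_of p < value_of (mediant p q)" "value_of (mediant p q) < value_of q"
  using unimodular_mediant[OF assms] by (auto intro: unimodular_less)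

lemma appears_in_level_mediant:
  assumes "neighbours_in_level (Suc n) p q"
  shows "appears_in_level (value_of (mediant p q)) (Suc (Suc n))"
proof -
  have "adjacent (insert_mediants (sb_level (Suc n))) p (mediant p q)"
    using assms by (intro adjacent_insert_mediants) (simp add: neighbours_in_level_iff_adjacent)
  then show ?thesis
    by (auto simp: adjacent_def appears_in_level_def)
qed

section \<open>Telescoping of the sum along nested Farey intervals\<close>

text \<open>Induction on the level. The coefficients depend only on \<alpha>, and the Farey
  intervals around \<alpha> are nested, so the formula for one level stays available on the interval
  of the next.\<close>

lemma farey_phi_on_farey_interval:
  assumes "0 < \<alpha>" "\<alpha> < 1" "\<And>j. 1 \<le> j \<Longrightarrow> j \<le> Suc n \<Longrightarrow> \<not> appears_in_level \<alpha> j"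
  obtains p q where "neighbours_in_level (Suc n) p q" "value_of p < \<alpha>" "\<alpha> < value_of q"
    "\<And>x. x \<in> {value_of p..value_of q} \<Longrightarrow>
       farey_phi (Suc n) \<alpha> x = 1 - max (left_gap p x) (right_gap q x)"
proof -
  have "\<exists>p q. neighbours_in_level (Suc n) p q \<and> value_of p < \<alpha> \<and> \<alpha> < value_of q \<and>
    (\<forall>x \<in> {value_of p..value_of q}.
       farey_phi (Suc n) \<alpha> x = 1 - max (left_gap p x) (right_gap q x))"
    using assms(3)
  proof (induction n)
    case 0
    have nb: "neighbours_in_level (Suc 0) (0, 1) (1, 1)"
      by (simp add: neighbours_in_level_iff_adjacent)
    have v: "value_of (0, 1) = 0" "value_of (1, 1) = 1"
      by (simp_all add: value_of_def)
    have I: "farey_interval (Suc 0) \<alpha> = ((0, 1), (1, 1))"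
      using nb assms v by (intro farey_interval_eq) auto
    \<comment> \<open>At level 1 the gaps are \<open>x\<close> and \<open>1 - x\<close>; their sum
      is 1, so their minimum is 1 minus their maximum.\<close>
    have "farey_phi (Suc 0) \<alpha> x = 1 - max (left_gap (0, 1) x) (right_gap (1, 1) x)" for x
      unfolding farey_phi_Suc I by (simp add: farey_phi_def left_gap_def right_gap_def)
    with nb v assms show ?case by (metis)
  next
    case (Suc n)
    then obtain p q where nb: "neighbours_in_level (Suc n) p q"
      and pq: "value_of p < \<alpha>" "\<alpha> < value_of q"
      and phi: "\<And>x. x \<in> {value_of p..value_of q} \<Longrightarrow>
        farey_phi (Suc n) \<alpha> x = 1 - max (left_gap p x) (right_gap q x)"
      by (metis le_SucI)
    let ?m = "mediant p q"
    have um: "unimodular p q" using nb by (rule neighbours_unimodular)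
    have adj: "neighbours_in_level (Suc (Suc n)) p ?m" "neighbours_in_level (Suc (Suc n)) ?m q"
      using nb adjacent_insert_mediants by (auto simp: neighbours_in_level_iff_adjacent)
    \<comment> \<open>The mediant already occurs in level \<open>Suc (Suc n)\<close>, where \<alpha>
      is assumed not to appear.\<close>
    have "\<alpha> \<noteq> value_of ?m"
      using appears_in_level_mediant[OF nb] Suc.prems[of "Suc (Suc n)"] by auto
    then consider "\<alpha> < value_of ?m" | "value_of ?m < \<alpha>" by linarith
    then show ?case
    proof cases
      case 1
      have I: "farey_interval (Suc (Suc n)) \<alpha> = (p, ?m)"
        using adj pq 1 by (intro farey_interval_eq)
      have "farey_phi (Suc (Suc n)) \<alpha> x = 1 - max (left_gap p x) (right_gap ?m x)"
        if x: "x \<in> {value_of p..value_of ?m}" for x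
      proof -
        \<comment> \<open>Left of the mediant the old maximum is \<open>Y = X + (Y - X)\<close>, the
          sum of the new pair. Adding the new minimum to 1 minus this sum leaves 1 minus the new
          maximum.\<close>
        have "left_gap p x \<le> right_gap q x"
          using gap_le_iff_mediant[OF um] x by simp
        moreover have "farey_phi (Suc n) \<alpha> x = 1 - max (left_gap p x) (right_gap q x)"
          using phi x mediant_between[OF um] by simp
        ultimately show ?thesis
          by (subst farey_phi_Suc) (simp add: I gaps_mediant max_def min_def)
      qed
      with adj pq 1 show ?thesis by blast
    next
      case 2
      have I: "farey_interval (Suc (Suc n)) \<alpha> = (?m, q)"
        using adj pq 2 by (intro farey_interval_eq)
      have "farey_phi (Suc (Suc n)) \<alpha> x = 1 - max (left_gap ?m x) (right_gap q x)"
        if x: "x \<in> {value_of ?m..value_of q}" for x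
      proof -
        \<comment> \<open>Symmetrically, the old maximum is now
          \<open>X = (X - Y) + Y\<close>.\<close>
        have "right_gap q x \<le> left_gap p x"
          using gap_le_iff_mediant[OF um] x by simp
        moreover have "farey_phi (Suc n) \<alpha> x = 1 - max (left_gap p x) (right_gap q x)"
          using phi x mediant_between[OF um] by simp
        ultimately show ?thesis
          by (subst farey_phi_Suc) (simp add: I gaps_mediant max_def min_def)
      qed
      with adj pq 2 show ?thesis by blast
    qed
  qed
  then show ?thesis using that by blast
qed

text \<open>A fraction new in a level is the mediant of some neighbours in the previous level. It
  lies strictly between them, so they must be the pair around \<alpha>.\<close>

lemma first_appearance_is_mediant:
  assumes "first_appears_in_level \<alpha> (Suc (Suc n))"
    and "neighbours_in_level (Suc n) p q" "value_of p < \<alpha>" "\<alpha> < value_of q"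
  shows "\<alpha> = value_of (mediant p q)"
proof -
  obtain r where r: "r \<in> set (sb_level (Suc (Suc n)))" "\<alpha> = value_of r"
    using assms(1) by (auto simp: first_appears_in_level_def appears_in_level_def)
  have "r \<notin> set (sb_level (Suc n))"
    using assms(1) r by (auto simp: first_appears_in_level_def appears_in_level_def)
  then obtain p' q' where p'q': "adjacent (sb_level (Suc n)) p' q'" "r = mediant p' q'"
    using r(1) by (auto elim: set_insert_mediants_cases)
  then have nb: "neighbours_in_level (Suc n) p' q'"
    by (simp add: neighbours_in_level_iff_adjacent)
  then have "p = p' \<and> q = q'"
    using mediant_between[OF neighbours_unimodular[OF nb]] assms(2-4) r p'q'
      neighbours_around_unique by metis
  then show ?thesis using r p'q' by simp
qed

section \<open>Graphs of affine functions and closures of graphs\<close>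

text \<open>The graph is the image of the segment \<open>{s..t}\<close> under the linear map
  \<open>x\<close> to \<open>(x, u * x)\<close>, followed by translation by
  \<open>(0, v)\<close>.\<close>

lemma graph_affine_eq_closed_segment:
  fixes s t u v :: real
  assumes "s \<le> t"
  shows "(\<lambda>x. (x, u * x + v)) ` {s..t} = closed_segment (s, u * s + v) (t, u * t + v)"
proof -
  have "linear (\<lambda>x. (x, u * x))"
    by (rule linearI) (auto simp: algebra_simps)
  then have "closed_segment (s, u * s) (t, u * t) = (\<lambda>x. (x, u * x)) ` {s..t}"
    using closed_segment_linear_image[of "\<lambda>x. (x, u * x)" s t] assms
    by (simp add: closed_segment_eq_real_ivl)
  then have "closed_segment ((0, v) + (s, u * s)) ((0, v) + (t, u * t)) =
      (+) (0, v) ` (\<lambda>x. (x, u * x)) ` {s..t}"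
    by (simp only: closed_segment_translation)
  then show ?thesis by (simp add: image_image add.commute)
qed

text \<open>The graph over the closed interval is compact, hence closed. Conversely, continuity maps
  the closure of the open interval into the closure of its graph.\<close>

lemma closure_graph_greaterThanLessThan:
  fixes g :: "real \<Rightarrow> real"
  assumes "s < t" "continuous_on {s..t} g"
  shows "closure ((\<lambda>x. (x, g x)) ` {s<..<t}) = (\<lambda>x. (x, g x)) ` {s..t}"
proof (rule antisym)
  have cont: "continuous_on {s..t} (\<lambda>x. (x, g x))"
    using assms by (intro continuous_intros)
  have "closed ((\<lambda>x. (x, g x)) ` {s..t})"
    using cont by (intro compact_imp_closed compact_continuous_image) auto
  then show "closure ((\<lambda>x. (x, g x)) ` {s<..<t}) \<subseteq> (\<lambda>x. (x, g x)) ` {s..t}"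
    by (intro closure_minimal image_mono) auto
  have "(\<lambda>x. (x, g x)) ` closure {s<..<t} \<subseteq> closure ((\<lambda>x. (x, g x)) ` {s<..<t})"
    using assms cont by (intro image_closure_subset closure_subset) auto
  then show "(\<lambda>x. (x, g x)) ` {s..t} \<subseteq> closure ((\<lambda>x. (x, g x)) ` {s<..<t})"
    using assms by simp
qed

section \<open>The two segments and the peak at \<alpha>\<close>

theorem theorem11:
  fixes \<alpha> :: real and n :: nat
  assumes "\<alpha> \<in> \<rat>" and "0 < \<alpha>" and "\<alpha> < 1"
    and "n \<ge> 1"
    and "first_appears_in_level \<alpha> (n + 1)"
  shows "let a = real (farey_a n \<alpha>); b = real (farey_b n \<alpha>);
             c = real (farey_c n \<alpha>); d = real (farey_d n \<alpha>);
             I = {a / b <..< c / d};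
             P = (a / b, (b - 1) / b);
             Q = ((a + c) / (b + d), (b + d - 1) / (b + d));
             R = (c / d, (d - 1) / d)
         in closure {(x, farey_phi n \<alpha> x) | x. x \<in> I} =
              closed_segment P Q \<union> closed_segment Q R \<and>
            \<alpha> = (a + c) / (b + d) \<and>
            is_arg_max (farey_phi n \<alpha>) (\<lambda>x. x \<in> I) \<alpha>"
proof -
  obtain k where k: "n = Suc k"
    using assms(4) by (cases n) auto
  have "\<not> appears_in_level \<alpha> j" if "1 \<le> j" "j \<le> Suc k" for j
    using assms(5) that k by (auto simp: first_appears_in_level_def)
  then obtain p q where nb: "neighbours_in_level n p q"
    and pq: "value_of p < \<alpha>" "\<alpha> < value_of q"
    and phi: "\<And>x. x \<in> {value_of p..value_of q} \<Longrightarrow>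
       farey_phi n \<alpha> x = 1 - max (left_gap p x) (right_gap q x)"
    using farey_phi_on_farey_interval[OF assms(2,3), of k] k by blast
  have um: "unimodular p q" using nb by (rule neighbours_unimodular)
  define a b c d where "a = real (fst p)" and "b = real (snd p)"
    and "c = real (fst q)" and "d = real (snd q)"
  note abcd = a_def b_def c_def d_def
  have farey: "farey_a n \<alpha> = fst p" "farey_b n \<alpha> = snd p" "farey_c n \<alpha> = fst q" "farey_d n \<alpha> = snd q"
    using farey_interval_eq[OF nb pq]
    by (simp_all add: farey_a_def farey_b_def farey_c_def farey_d_def)
  have pos: "b > 0" "d > 0" using um by (simp_all add: unimodular_def abcd)
  have det: "b * c - a * d = 1" using unimodular_real[OF um] by (simp add: abcd)
  have val: "value_of p = a / b" "value_of q = c / d" by (simp_all add: value_of_def abcd)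
  have med: "value_of (mediant p q) = (a + c) / (b + d)" by (simp add: value_of_mediant abcd)
  define m where "m = (a + c) / (b + d)"
  have m: "\<alpha> = m"
    using first_appearance_is_mediant[of \<alpha> k p q] assms(5) nb pq k med by (simp add: m_def)
  have bnd: "a / b < m" "m < c / d"
    using pq val m by auto
  \<comment> \<open>The closed formula for \<phi> is continued to the whole line: a tent of two
    affine pieces meeting at \<open>m\<close>.\<close>
  define g where "g x = 1 - max (b * x - a) (c - d * x)" for x
  have phi': "farey_phi n \<alpha> x = g x" if "x \<in> {a / b..c / d}" for x
    using phi[of x] that by (simp add: val g_def left_gap_def right_gap_def abcd)
  have gap: "b * x - a \<le> c - d * x \<longleftrightarrow> x \<le> m" for x
    using gap_le_iff_mediant[OF um, of x] by (simp add: left_gap_def right_gap_def med m_def abcd)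
  \<comment> \<open>At the mediant both gaps equal \<open>(b c - a d) / (b + d)\<close>.\<close>
  have bm: "b * m - a = 1 / (b + d)" and dm: "c - d * m = 1 / (b + d)"
    using pos det by (simp_all add: m_def field_simps)

  have left: "(\<lambda>x. (x, g x)) ` {a / b..m} =
      closed_segment (a / b, (b - 1) / b) (m, (b + d - 1) / (b + d))"
  proof -
    \<comment> \<open>Up to \<open>m\<close> the right gap is the larger one, so
      \<open>g x = 1 - (c - d * x)\<close>; the determinant identity then gives the end
      values.\<close>
    have "(\<lambda>x. (x, g x)) ` {a / b..m} = (\<lambda>x. (x, d * x + (1 - c))) ` {a / b..m}"
      using gap by (intro image_cong) (auto simp: g_def max_def)
    moreover have "d * (a / b) + (1 - c) = (b - 1) / b"
      using pos det by (simp add: field_simps)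
    moreover have "d * m + (1 - c) = (b + d - 1) / (b + d)"
      using pos dm by (simp add: field_simps)
    ultimately show ?thesis
      using graph_affine_eq_closed_segment[of "a / b" m d "1 - c"] bnd by simp
  qed
  have right: "(\<lambda>x. (x, g x)) ` {m..c / d} =
      closed_segment (m, (b + d - 1) / (b + d)) (c / d, (d - 1) / d)"
  proof -
    have "g x = - b * x + (1 + a)" if "x \<ge> m" for x
      \<comment> \<open>At \<open>x = m\<close> the definition of \<open>max\<close> selects the
        right gap, so the equality of both gaps there is needed to switch to the left one.\<close>
      using gap[of x] that bm dm by (cases "x = m") (auto simp: g_def max_def)
    then have "(\<lambda>x. (x, g x)) ` {m..c / d} = (\<lambda>x. (x, - b * x + (1 + a))) ` {m..c / d}"
      by (intro image_cong) auto
    moreover have "- b * (c / d) + (1 + a) = (d - 1) / d"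
      using pos det by (simp add: field_simps)
    moreover have "- b * m + (1 + a) = (b + d - 1) / (b + d)"
      using pos bm by (simp add: field_simps)
    ultimately show ?thesis
      using graph_affine_eq_closed_segment[of m "c / d" "- b" "1 + a"] bnd by simp
  qed
  have "{(x, farey_phi n \<alpha> x) | x. x \<in> {a / b<..<c / d}} = (\<lambda>x. (x, g x)) ` {a / b<..<c / d}"
    using phi' by force
  also have "closure \<dots> = (\<lambda>x. (x, g x)) ` {a / b..c / d}"
    unfolding g_def using bnd
    by (intro closure_graph_greaterThanLessThan continuous_intros) auto
  also have "{a / b..c / d} = {a / b..m} \<union> {m..c / d}"
    using bnd by auto
  finally have closure: "closure {(x, farey_phi n \<alpha> x) | x. x \<in> {a / b<..<c / d}} =
      closed_segment (a / b, (b - 1) / b) (m, (b + d - 1) / (b + d)) \<union>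
      closed_segment (m, (b + d - 1) / (b + d)) (c / d, (d - 1) / d)"
    by (simp only: image_Un left right)

  have "g x \<le> g m" for x
  proof -
    \<comment> \<open>The gaps, weighted by \<open>d\<close> and \<open>b\<close>, always sum to 1,
      so the larger one is at least \<open>1 / (b + d)\<close>. At \<open>m\<close> both have
      exactly this value, hence \<open>g\<close> peaks there.\<close>
    have "1 = d * (b * x - a) + b * (c - d * x)"
      using det by (simp add: algebra_simps)
    also have "\<dots> \<le> d * max (b * x - a) (c - d * x) + b * max (b * x - a) (c - d * x)"
      using pos by (intro add_mono mult_left_mono) auto
    finally have "1 / (b + d) \<le> max (b * x - a) (c - d * x)"
      using pos by (simp add: divide_le_eq algebra_simps)
    then show ?thesis by (simp only: g_def bm dm)
  qed
  then have "is_arg_max (farey_phi n \<alpha>) (\<lambda>x. x \<in> {a / b<..<c / d}) \<alpha>"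
    using bnd phi' unfolding m is_arg_max_def by (auto simp: not_less[symmetric] not_le)
  with closure m show ?thesis
    unfolding Let_def farey abcd[symmetric] m_def by blast
qed

end
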